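(* A 2-step nilpotent Lie group $(N(j),g)$ with left-invariant metric, determined by a linear map $j:\mathfrak z\to\mathfrak{so}(\mathfrak v)$, is a Type $\mathcal A$ manifold if and only if $J\circ j_{X^{\mathfrak z}}$ is a skew-symmetric endomorphism of $\mathfrak v$ for every $X^{\mathfrak z}\in\mathfrak z$.
   Context: Setting: $\mathfrak v,\mathfrak z$ are finite-dimensional real vector spaces, $\mathfrak n=\mathfrak v\oplus\mathfrak z$ carries an inner product $g$ with $\mathfrak v\perp\mathfrak z$, and each $X\in\mathfrak n$ is written $X=X^{\mathfrak v}+X^{\mathfrak z}$. Given a linear map $j:\mathfrak z\to\mathfrak{so}(\mathfrak v)$, $Z\mapsto j_Z$, the Lie bracket on $\mathfrak n$ is defined by $[\mathfrak n,\mathfrak z]=0$, $[\mathfrak v,\mathfrak v]\subseteq\mathfrak z$ and $g([X^{\mathfrak v},Y^{\mathfrak v}],Z^{\mathfrak z})=g(j_{Z^{\mathfrak z}}X^{\mathfrak v},Y^{\mathfrak v})$. $N(j)$ is the simply connected Lie group with this Lie algebra, with the left-invariant Riemannian metric (also denoted $g$) induced by $g$. For an orthonormal basis $\{z_k\}$ of $\mathfrak z$, define $J:\mathfrak v\to\mathfrak v$, $J(X^{\mathfrak v})=\sum_k j_{z_k}j_{z_k}X^{\mathfrak v}$. A Riemannian manifold $(M,g)$ is of Type $\mathcal A$ if its Ricci tensor $\mathrm{ric}$ is cyclic parallel, i.e. $(\nabla_X\mathrm{ric})(X,X)=0$ for every vector field $X$, where $\nabla$ is the Levi-Civita connection. 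*)

theory Defs
  imports "HOL-Analysis.Analysis"
begin

section \<open>Riemannian geometry in one global chart\<close>

text \<open>The manifold is a Euclidean space \<open>'n\<close>, regarded as a smooth manifold with a single chart. Tangent
  spaces are identified with \<open>'n\<close>, so that a vector field is a function \<open>'n \<Rightarrow> 'n\<close> and a Riemannian
  metric is a function \<open>g\<close> with \<open>g p u w\<close> the inner product of the tangent vectors \<open>u\<close>, \<open>w\<close> at \<open>p\<close>.
  The inner product of the type \<open>'n\<close> plays no role in this section beyond providing coordinates.\<close>

primrec C_k :: "nat \<Rightarrow> ('a::real_normed_vector \<Rightarrow> 'b::real_normed_vector) \<Rightarrow> bool" where
  "C_k 0 f \<longleftrightarrow> continuous_on UNIV f"
| "C_k (Suc k) f \<longleftrightarrow>
     f differentiable_on UNIV \<and> (\<forall>v. C_k k (\<lambda>p. frechet_derivative f (at p) v))"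

definition smooth :: "('a::real_normed_vector \<Rightarrow> 'b::real_normed_vector) \<Rightarrow> bool" where
  "smooth f \<longleftrightarrow> (\<forall>k. C_k k f)"

definition deriv_along ::
    "('a::real_normed_vector \<Rightarrow> 'a) \<Rightarrow> ('a \<Rightarrow> 'b::real_normed_vector) \<Rightarrow> 'a \<Rightarrow> 'b" where
  "deriv_along X f p = frechet_derivative f (at p) (X p)"

definition field_bracket ::
    "('a::real_normed_vector \<Rightarrow> 'a) \<Rightarrow> ('a \<Rightarrow> 'a) \<Rightarrow> 'a \<Rightarrow> 'a" where
  "field_bracket X Y p = deriv_along X Y p - deriv_along Y X p"

definition is_levi_civita ::
    "('a \<Rightarrow> 'a \<Rightarrow> 'a \<Rightarrow> real) \<Rightarrow>
     (('a::euclidean_space \<Rightarrow> 'a) \<Rightarrow> ('a \<Rightarrow> 'a) \<Rightarrow> ('a \<Rightarrow> 'a)) \<Rightarrow> bool" where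
  "is_levi_civita g D \<longleftrightarrow>
     (\<forall>X Y. smooth X \<longrightarrow> smooth Y \<longrightarrow> smooth (D X Y)) \<and>
     (\<forall>X X' Y. smooth X \<longrightarrow> smooth X' \<longrightarrow> smooth Y \<longrightarrow>
        D (\<lambda>p. X p + X' p) Y = (\<lambda>p. D X Y p + D X' Y p)) \<and>
     (\<forall>(f :: 'a \<Rightarrow> real) X Y. smooth f \<longrightarrow> smooth X \<longrightarrow> smooth Y \<longrightarrow>
        D (\<lambda>p. f p *\<^sub>R X p) Y = (\<lambda>p. f p *\<^sub>R D X Y p)) \<and>
     (\<forall>X Y Y'. smooth X \<longrightarrow> smooth Y \<longrightarrow> smooth Y' \<longrightarrow>
        D X (\<lambda>p. Y p + Y' p) = (\<lambda>p. D X Y p + D X Y' p)) \<and>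
     (\<forall>(f :: 'a \<Rightarrow> real) X Y. smooth f \<longrightarrow> smooth X \<longrightarrow> smooth Y \<longrightarrow>
        D X (\<lambda>p. f p *\<^sub>R Y p) = (\<lambda>p. deriv_along X f p *\<^sub>R Y p + f p *\<^sub>R D X Y p)) \<and>
     (\<forall>X Y. smooth X \<longrightarrow> smooth Y \<longrightarrow>
        (\<lambda>p. D X Y p - D Y X p) = field_bracket X Y) \<and>
     (\<forall>X Y Z. smooth X \<longrightarrow> smooth Y \<longrightarrow> smooth Z \<longrightarrow>
        deriv_along X (\<lambda>p. g p (Y p) (Z p)) =
          (\<lambda>p. g p (D X Y p) (Z p) + g p (Y p) (D X Z p)))"

text \<open>By the fundamental theorem of Riemannian geometry a smooth metric \<open>g\<close> has such an operator, unique
  on smooth vector fields. Its values on other fields are arbitrary and are never used below.\<close>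

definition levi_civita ::
    "('a \<Rightarrow> 'a \<Rightarrow> 'a \<Rightarrow> real) \<Rightarrow>
     ('a::euclidean_space \<Rightarrow> 'a) \<Rightarrow> ('a \<Rightarrow> 'a) \<Rightarrow> ('a \<Rightarrow> 'a)" where
  "levi_civita g = (SOME D. is_levi_civita g D)"

definition riemann ::
    "('a \<Rightarrow> 'a \<Rightarrow> 'a \<Rightarrow> real) \<Rightarrow>
     ('a::euclidean_space \<Rightarrow> 'a) \<Rightarrow> ('a \<Rightarrow> 'a) \<Rightarrow> ('a \<Rightarrow> 'a) \<Rightarrow> ('a \<Rightarrow> 'a)" where
  "riemann g X Y Z p =
     (let D = levi_civita g
      in D X (D Y Z) p - D Y (D X Z) p - D (field_bracket X Y) Z p)"

text \<open>The trace of the endomorphism \<open>u \<mapsto> R(u, Y)Z\<close> of the tangent space at \<open>p\<close>. A tangent vector is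
  extended to a constant field, which is harmless since \<open>R\<close> is tensorial; \<open>Basis\<close> is just a
  coordinate basis, with \<open>\<lambda>w. w \<bullet> b\<close> its dual basis, and need not be orthonormal for \<open>g\<close>.\<close>

definition ricci ::
    "('a \<Rightarrow> 'a \<Rightarrow> 'a \<Rightarrow> real) \<Rightarrow>
     ('a::euclidean_space \<Rightarrow> 'a) \<Rightarrow> ('a \<Rightarrow> 'a) \<Rightarrow> 'a \<Rightarrow> real" where
  "ricci g Y Z p = (\<Sum>b\<in>Basis. riemann g (\<lambda>_. b) Y Z p \<bullet> b)"

definition nabla_ricci ::
    "('a \<Rightarrow> 'a \<Rightarrow> 'a \<Rightarrow> real) \<Rightarrow>
     ('a::euclidean_space \<Rightarrow> 'a) \<Rightarrow> ('a \<Rightarrow> 'a) \<Rightarrow> ('a \<Rightarrow> 'a) \<Rightarrow> 'a \<Rightarrow> real" where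
  "nabla_ricci g X Y Z p =
     deriv_along X (ricci g Y Z) p
       - ricci g (levi_civita g X Y) Z p - ricci g Y (levi_civita g X Z) p"

definition type_A :: "('a::euclidean_space \<Rightarrow> 'a \<Rightarrow> 'a \<Rightarrow> real) \<Rightarrow> bool" where
  "type_A g \<longleftrightarrow> (\<forall>X. smooth X \<longrightarrow> (\<forall>p. nabla_ricci g X X X p = 0))"


section \<open>The group \<open>N(j)\<close> and its left-invariant metric\<close>

definition so :: "('v::real_inner \<Rightarrow>\<^sub>L 'v) set" where
  "so = {A :: 'v \<Rightarrow>\<^sub>L 'v. \<forall>x y. A x \<bullet> y = - (x \<bullet> A y)}"

text \<open>The Lie algebra is the orthogonal sum \<open>'v \<times> 'z\<close>; the inner product of a product type makes the
  two factors orthogonal.\<close>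

definition nil_bracket ::
    "('z::euclidean_space \<Rightarrow> 'v::euclidean_space \<Rightarrow>\<^sub>L 'v) \<Rightarrow> 'v \<times> 'z \<Rightarrow> 'v \<times> 'z \<Rightarrow> 'v \<times> 'z" where
  "nil_bracket j X Y =
     (THE W. fst W = 0 \<and> (\<forall>Z. snd W \<bullet> Z = j Z (fst X) \<bullet> fst Y))"

text \<open>The simply connected group in exponential coordinates: by the Baker--Campbell--Hausdorff formula,
  which stops after the first bracket for a 2-step nilpotent algebra. The neutral element is \<open>0\<close> and
  the inverse of \<open>p\<close> is \<open>- p\<close>.\<close>

definition nil_mult ::
    "('z::euclidean_space \<Rightarrow> 'v::euclidean_space \<Rightarrow>\<^sub>L 'v) \<Rightarrow> 'v \<times> 'z \<Rightarrow> 'v \<times> 'z \<Rightarrow> 'v \<times> 'z" where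
  "nil_mult j p q = p + q + (1/2) *\<^sub>R nil_bracket j p q"

definition nil_metric ::
    "('z::euclidean_space \<Rightarrow> 'v::euclidean_space \<Rightarrow>\<^sub>L 'v) \<Rightarrow> 'v \<times> 'z \<Rightarrow> 'v \<times> 'z \<Rightarrow> 'v \<times> 'z \<Rightarrow> real" where
  "nil_metric j p u w =
     frechet_derivative (nil_mult j (- p)) (at p) u \<bullet>
     frechet_derivative (nil_mult j (- p)) (at p) w"

definition orthonormal_basis :: "'a::real_inner set \<Rightarrow> bool" where
  "orthonormal_basis B \<longleftrightarrow> pairwise orthogonal B \<and> (\<forall>b\<in>B. norm b = 1) \<and> span B = UNIV"

definition J_op :: "'z set \<Rightarrow> ('z \<Rightarrow> 'v::real_normed_vector \<Rightarrow>\<^sub>L 'v) \<Rightarrow> 'v \<Rightarrow>\<^sub>L 'v" where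
  "J_op B j = (\<Sum>b\<in>B. j b o\<^sub>L j b)"


subsection \<open>The encoding agrees with the intended objects\<close>

lemma nil_bracket_sum_inner:
  fixes j :: "'z::euclidean_space \<Rightarrow> 'v::euclidean_space \<Rightarrow>\<^sub>L 'v"
  assumes "linear j"
  shows "(\<Sum>b\<in>Basis. (j b x \<bullet> y) *\<^sub>R b) \<bullet> Z = j Z x \<bullet> y"
proof -
  have "j Z = j (\<Sum>b\<in>Basis. (Z \<bullet> b) *\<^sub>R b)" by (simp add: euclidean_representation)
  also have "\<dots> = (\<Sum>b\<in>Basis. (Z \<bullet> b) *\<^sub>R j b)"
    using assms by (simp add: linear_sum linear_cmul)
  finally have "j Z x \<bullet> y = (\<Sum>b\<in>Basis. (Z \<bullet> b) * (j b x \<bullet> y))"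
    by (simp add: blinfun.sum_left blinfun.scaleR_left inner_sum_left)
  also have "\<dots> = (\<Sum>b\<in>Basis. (j b x \<bullet> y) *\<^sub>R b) \<bullet> Z"
    unfolding inner_sum_left by (rule sum.cong) (simp_all add: inner_commute)
  finally show ?thesis by simp
qed

lemma nil_bracket_explicit:
  fixes j :: "'z::euclidean_space \<Rightarrow> 'v::euclidean_space \<Rightarrow>\<^sub>L 'v"
  assumes "linear j"
  shows "nil_bracket j X Y = (0, \<Sum>b\<in>Basis. (j b (fst X) \<bullet> fst Y) *\<^sub>R b)"
proof -
  let ?w = "\<Sum>b\<in>Basis. (j b (fst X) \<bullet> fst Y) *\<^sub>R b"
  note eq = nil_bracket_sum_inner[OF assms, of "fst X" "fst Y"]
  show ?thesis
    unfolding nil_bracket_def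
  proof (rule the_equality)
    show "fst (0::'v, ?w) = 0 \<and> (\<forall>Z. snd (0::'v, ?w) \<bullet> Z = j Z (fst X) \<bullet> fst Y)"
      using eq by simp
  next
    fix W :: "'v \<times> 'z"
    assume W: "fst W = 0 \<and> (\<forall>Z. snd W \<bullet> Z = j Z (fst X) \<bullet> fst Y)"
    then have "\<forall>Z. snd W \<bullet> Z = ?w \<bullet> Z" using eq by simp
    then have "snd W = ?w" using vector_eq_rdot by blast
    with W show "W = (0, ?w)" by (simp add: prod_eq_iff)
  qed
qed

lemma nil_bracket_char:
  assumes "linear j"
  shows "fst (nil_bracket j X Y) = 0"
    and "nil_bracket j X Y \<bullet> (0, Z) = j Z (fst X) \<bullet> fst Y"
  by (simp_all add: nil_bracket_explicit[OF assms] nil_bracket_sum_inner[OF assms])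

lemma nil_bracket_bilinear:
  assumes "linear j"
  shows "nil_bracket j (X + X') Y = nil_bracket j X Y + nil_bracket j X' Y"
    and "nil_bracket j X (Y + Y') = nil_bracket j X Y + nil_bracket j X Y'"
    and "nil_bracket j (c *\<^sub>R X) Y = c *\<^sub>R nil_bracket j X Y"
    and "nil_bracket j X (c *\<^sub>R Y) = c *\<^sub>R nil_bracket j X Y"
  by (simp_all add: nil_bracket_explicit[OF assms] blinfun.bilinear_simps inner_add_left
      inner_add_right scaleR_left_distrib sum.distrib scaleR_sum_right)

lemma nil_bracket_skew:
  assumes "linear j" "range j \<subseteq> so"
  shows "nil_bracket j Y X = - nil_bracket j X Y"
proof -
  have "j b (fst Y) \<bullet> fst X = - (j b (fst X) \<bullet> fst Y)" for b
    using assms(2) by (auto simp: so_def inner_commute)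
  then show ?thesis by (simp add: nil_bracket_explicit[OF assms(1)] sum_negf)
qed

lemma nil_bracket_2_step:
  assumes "linear j"
  shows "nil_bracket j (nil_bracket j X Y) W = 0" "nil_bracket j W (nil_bracket j X Y) = 0"
  by (simp_all add: nil_bracket_explicit[OF assms] zero_prod_def)

lemma nil_bracket_self:
  assumes "linear j" "range j \<subseteq> so"
  shows "nil_bracket j X X = 0"
proof -
  have "nil_bracket j X X = - nil_bracket j X X" by (rule nil_bracket_skew[OF assms])
  then show ?thesis by (simp add: eq_neg_iff_add_eq_0 flip: scaleR_2)
qed

lemma nil_mult_group:
  assumes "linear j" "range j \<subseteq> so"
  shows "nil_mult j (nil_mult j p q) r = nil_mult j p (nil_mult j q r)"
    and "nil_mult j 0 p = p" "nil_mult j p 0 = p"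
    and "nil_mult j (- p) p = 0" "nil_mult j p (- p) = 0"
proof -
  note bl = nil_bracket_bilinear[OF assms(1)]
  show "nil_mult j (nil_mult j p q) r = nil_mult j p (nil_mult j q r)"
    by (simp add: nil_mult_def bl nil_bracket_2_step[OF assms(1)] algebra_simps)
  show "nil_mult j 0 p = p" "nil_mult j p 0 = p"
    using bl(3)[of 0 0 p] bl(4)[of p 0 0] by (simp_all add: nil_mult_def)
  show "nil_mult j (- p) p = 0" "nil_mult j p (- p) = 0"
    using bl(3)[of "-1" p p] bl(4)[of p "-1" p] nil_bracket_self[OF assms, of p]
    by (simp_all add: nil_mult_def)
qed

lemma nil_mult_has_derivative:
  assumes "linear j"
  shows "(nil_mult j q has_derivative (\<lambda>u. u + (1/2) *\<^sub>R nil_bracket j q u)) (at p)"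
proof -
  have "linear (nil_bracket j q)"
    by (rule linearI) (simp_all add: nil_bracket_bilinear[OF assms])
  then have "(nil_bracket j q has_derivative nil_bracket j q) (at p)"
    by (simp add: linear_imp_has_derivative)
  then show ?thesis
    unfolding nil_mult_def[abs_def] by (auto intro!: derivative_eq_intros)
qed

lemma nil_mult_frechet:
  assumes "linear j"
  shows "frechet_derivative (nil_mult j q) (at p) u = u + (1/2) *\<^sub>R nil_bracket j q u"
  using frechet_derivative_at[OF nil_mult_has_derivative[OF assms, of q p]] by metis

lemma nil_metric_left_invariant:
  assumes "linear j" "range j \<subseteq> so"
  shows "nil_metric j (nil_mult j q p)
           (frechet_derivative (nil_mult j q) (at p) u) (frechet_derivative (nil_mult j q) (at p) w)
         = nil_metric j p u w"
    and "nil_metric j 0 u w = u \<bullet> w"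
proof -
  note bl = nil_bracket_bilinear[OF assms(1)]
  have neg: "nil_bracket j (- a) b = - nil_bracket j a b" for a b
    using bl(3)[of "-1" a b] by simp
  have diff: "nil_bracket j (a - b) c = nil_bracket j a c - nil_bracket j b c" for a b c
    using bl(1)[of a "- b" c] by (simp add: neg)
  have "nil_bracket j 0 a = 0" for a
    using bl(3)[of 0 0 a] by simp
  then show "nil_metric j 0 u w = u \<bullet> w"
    by (simp add: nil_metric_def nil_mult_frechet[OF assms(1)])
  have "frechet_derivative (nil_mult j (- nil_mult j q p)) (at (nil_mult j q p))
          (frechet_derivative (nil_mult j q) (at p) u)
        = frechet_derivative (nil_mult j (- p)) (at p) u" for u
    by (simp add: nil_mult_frechet[OF assms(1)] neg diff bl nil_mult_def
        nil_bracket_2_step[OF assms(1)] scaleR_add_right scaleR_diff_right)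
  then show "nil_metric j (nil_mult j q p)
           (frechet_derivative (nil_mult j q) (at p) u) (frechet_derivative (nil_mult j q) (at p) w)
         = nil_metric j p u w"
    unfolding nil_metric_def by simp
qed

text \<open>The bracket of left-invariant vector fields is the given bracket of \<open>'v \<times> 'z\<close>, so \<open>nil_mult\<close>
  is indeed the simply connected group with this Lie algebra.\<close>

lemma left_invariant_bracket:
  assumes "linear j" "range j \<subseteq> so"
  defines "E \<equiv> \<lambda>u p. frechet_derivative (nil_mult j p) (at 0) u"
  shows "field_bracket (E u) (E w) = E (nil_bracket j u w)"
proof
  fix p
  have E: "E u = (\<lambda>p. u + (1/2) *\<^sub>R nil_bracket j p u)" for u
    by (simp add: E_def nil_mult_frechet[OF assms(1)])
  have "linear (\<lambda>p. nil_bracket j p u)" for u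
    by (rule linearI) (simp_all add: nil_bracket_bilinear[OF assms(1)])
  then have hd: "((\<lambda>p. nil_bracket j p u) has_derivative (\<lambda>h. nil_bracket j h u)) (at p)" for u
    by (rule linear_imp_has_derivative)
  have "(E u has_derivative (\<lambda>h. (1/2) *\<^sub>R nil_bracket j h u)) (at p)" for u
    unfolding E using hd[of u] by (auto intro!: derivative_eq_intros)
  from frechet_derivative_at[OF this]
  have d: "frechet_derivative (E u) (at p) h = (1/2) *\<^sub>R nil_bracket j h u" for u h
    by metis
  have "field_bracket (E u) (E w) p
      = (1/2) *\<^sub>R nil_bracket j u w - (1/2) *\<^sub>R nil_bracket j w u"
    unfolding field_bracket_def deriv_along_def d
    by (simp add: E nil_bracket_bilinear[OF assms(1)] nil_bracket_2_step[OF assms(1)])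
  also have "\<dots> = nil_bracket j u w"
    unfolding nil_bracket_skew[OF assms(1,2), where X = u and Y = w]
    by (simp flip: scaleR_left_distrib)
  also have "\<dots> = E (nil_bracket j u w) p"
    by (simp add: E nil_bracket_2_step[OF assms(1)])
  finally show "field_bracket (E u) (E w) p = E (nil_bracket j u w) p" .
qed

end

theory Submission
  imports Defs
begin

text \<open>
  Transporting every tangent vector at \<open>p\<close> to the neutral element by left translation turns a vector
  field \<open>X\<close> into a Lie algebra valued function \<open>hat X\<close>. In these terms the metric is the constant inner
  product, and the Levi-Civita connection is the directional derivative of \<open>hat Y\<close> plus the constant
  bilinear term \<open>conn\<close> given by Koszul's formula on left-invariant fields. Hence curvature and Ricci tensor
  become constant multilinear forms \<open>curv\<close> and \<open>ric\<close>; the second derivatives drop out of the curvature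
  because they are symmetric. The derivative terms cancel in \<open>(\<nabla>\<^sub>X ric)(X, X)\<close>, which becomes
  \<open>- 2 ric (conn u u) u\<close> with \<open>u = hat X p = (x, z)\<close> arbitrary. Since \<open>conn u u = (- j\<^sub>z x, 0)\<close> and \<open>ric\<close>
  pairs \<open>(y, 0)\<close> with \<open>(x, z)\<close> to \<open>J y \<bullet> x / 2\<close>, the condition says that the quadratic form of \<open>J \<circ> j\<^sub>z\<close>
  vanishes for every \<open>z\<close>.
\<close>

section \<open>Smooth functions and second derivatives\<close>

lemma C_k_Suc_imp: "C_k (Suc k) f \<Longrightarrow> C_k k f"
proof (induction k arbitrary: f)
  case 0
  then show ?case by (simp add: differentiable_imp_continuous_on)
next
  case (Suc k)
  then show ?case by (metis C_k.simps(2))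
qed

lemma smooth_differentiable: "smooth f \<Longrightarrow> f differentiable (at p)"
  using C_k.simps(2)[of 0 f] by (auto simp: smooth_def differentiable_on_def)

lemma smooth_has_derivative:
  "smooth f \<Longrightarrow> (f has_derivative frechet_derivative f (at p)) (at p)"
  using smooth_differentiable frechet_derivative_works by blast

lemma smooth_frechet: "smooth f \<Longrightarrow> smooth (\<lambda>p. frechet_derivative f (at p) v)"
  unfolding smooth_def by (metis C_k.simps(2))

lemma smooth_continuous_on: "smooth f \<Longrightarrow> continuous_on S f"
  unfolding smooth_def by (metis C_k.simps(1) continuous_on_subset subset_UNIV)

section \<open>Closure of \<open>C_k\<close> and \<open>smooth\<close> under algebraic
  operations\<close>

lemma C_k_const: "C_k k (\<lambda>_. c)"
  by (induction k arbitrary: c) auto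

lemma C_k_add: "C_k k f \<Longrightarrow> C_k k g \<Longrightarrow> C_k k (\<lambda>p. f p + g p)"
proof (induction k arbitrary: f g)
  case 0
  then show ?case by (simp add: continuous_on_add)
next
  case (Suc k)
  then have d: "f differentiable (at p)" "g differentiable (at p)" for p
    by (auto simp: differentiable_on_def)
  have hd: "((\<lambda>p. f p + g p) has_derivative
      (\<lambda>v. frechet_derivative f (at p) v + frechet_derivative g (at p) v)) (at p)" for p
    using d[of p] unfolding frechet_derivative_works by (rule has_derivative_add)
  have e: "frechet_derivative (\<lambda>p. f p + g p) (at p)
      = (\<lambda>v. frechet_derivative f (at p) v + frechet_derivative g (at p) v)" for p
    by (rule frechet_derivative_at[OF hd, symmetric])
  show ?case
    using Suc d unfolding C_k.simps e by (auto simp: differentiable_on_def)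
qed

lemma C_k_bounded_linear: "bounded_linear h \<Longrightarrow> C_k k f \<Longrightarrow> C_k k (\<lambda>p. h (f p))"
proof (induction k arbitrary: f)
  case 0
  then show ?case by (simp add: bounded_linear.continuous_on)
next
  case (Suc k)
  then have d: "f differentiable (at p)" for p
    by (auto simp: differentiable_on_def)
  have hd: "((\<lambda>p. h (f p)) has_derivative (\<lambda>v. h (frechet_derivative f (at p) v))) (at p)" for p
    using d[of p] unfolding frechet_derivative_works
    by (rule bounded_linear.has_derivative[OF Suc.prems(1)])
  have e: "frechet_derivative (\<lambda>p. h (f p)) (at p)
      = (\<lambda>v. h (frechet_derivative f (at p) v))" for p
    by (rule frechet_derivative_at[OF hd, symmetric])
  show ?case
    using Suc hd unfolding C_k.simps e differentiable_on_def by (auto intro: differentiableI)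
qed

text \<open>A single Leibniz-rule induction serves every product that occurs: scalar multiplication,
  inner product, Lie bracket and \<open>conn\<close>.\<close>

lemma C_k_bounded_bilinear:
  assumes "bounded_bilinear h"
  shows "C_k k f \<Longrightarrow> C_k k g \<Longrightarrow> C_k k (\<lambda>p. h (f p) (g p))"
proof (induction k arbitrary: f g)
  case 0
  then show ?case using assms by (simp add: bounded_bilinear.continuous_on)
next
  case (Suc k)
  then have d: "f differentiable (at p)" "g differentiable (at p)" for p
    by (auto simp: differentiable_on_def)
  have hd: "((\<lambda>p. h (f p) (g p)) has_derivative
      (\<lambda>v. h (f p) (frechet_derivative g (at p) v) + h (frechet_derivative f (at p) v) (g p)))
      (at p)" for p
    using d[of p] unfolding frechet_derivative_works by (rule bounded_bilinear.FDERIV[OF assms])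
  have e: "frechet_derivative (\<lambda>p. h (f p) (g p)) (at p)
      = (\<lambda>v. h (f p) (frechet_derivative g (at p) v) + h (frechet_derivative f (at p) v) (g p))"
    for p
    by (rule frechet_derivative_at[OF hd, symmetric])
  \<comment> \<open>Each summand of the product rule keeps one undifferentiated factor, so the
    induction hypothesis also has to be fed \<open>f\<close> and \<open>g\<close> themselves at
    level \<open>k\<close>.\<close>
  have "C_k k f" "C_k k g"
    using Suc.prems by (blast intro: C_k_Suc_imp)+
  moreover have "(\<lambda>p. h (f p) (g p)) differentiable_on UNIV"
    using hd unfolding differentiable_on_def by (blast intro: differentiableI)
  ultimately show ?case
    using Suc unfolding C_k.simps e by (intro conjI allI C_k_add) simp_all
qed

lemma C_k_ident: "C_k k (\<lambda>p. p)"
  by (cases k) (auto simp: differentiable_on_def C_k_const)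

lemma smooth_const: "smooth (\<lambda>_. c)"
  by (simp add: smooth_def C_k_const)

lemma smooth_ident: "smooth (\<lambda>p. p)"
  by (simp add: smooth_def C_k_ident)

lemma smooth_add: "smooth f \<Longrightarrow> smooth g \<Longrightarrow> smooth (\<lambda>p. f p + g p)"
  by (simp add: smooth_def C_k_add)

lemma smooth_bounded_linear: "bounded_linear h \<Longrightarrow> smooth f \<Longrightarrow> smooth (\<lambda>p. h (f p))"
  by (simp add: smooth_def C_k_bounded_linear)

lemma smooth_bounded_bilinear:
  "bounded_bilinear h \<Longrightarrow> smooth f \<Longrightarrow> smooth g \<Longrightarrow> smooth (\<lambda>p. h (f p) (g p))"
  by (simp add: smooth_def C_k_bounded_bilinear)

lemmas smooth_scaleR = smooth_bounded_bilinear[OF bounded_bilinear_scaleR]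
lemmas smooth_inner = smooth_bounded_bilinear[OF bounded_bilinear_inner]

lemma smooth_diff:
  assumes "smooth f" "smooth g"
  shows "smooth (\<lambda>p. f p - g p)"
  using smooth_add[OF assms(1) smooth_bounded_linear[OF bounded_linear_minus[OF bounded_linear_ident] assms(2)]]
    by simp

lemma smooth_sum: "(\<And>b. b \<in> S \<Longrightarrow> smooth (f b)) \<Longrightarrow> smooth (\<lambda>p. \<Sum>b\<in>S. f b p)"
  by (induction S rule: infinite_finite_induct) (auto intro: smooth_const smooth_add)

text \<open>\<open>smooth\<close> only controls derivatives in a fixed direction, whereas here the
  direction \<open>X p\<close> moves with the point; expanding it in \<open>Basis\<close> separates
  the two dependences.\<close>

lemma smooth_deriv_along:
  fixes X :: "'a::euclidean_space \<Rightarrow> 'a"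
  assumes "smooth X" "smooth f"
  shows "smooth (deriv_along X f)"
proof -
  have "frechet_derivative f (at p) (X p)
      = (\<Sum>b\<in>Basis. (X p \<bullet> b) *\<^sub>R frechet_derivative f (at p) b)" for p
  proof -
    interpret bounded_linear "frechet_derivative f (at p)"
      using smooth_has_derivative[OF assms(2)] by (rule has_derivative_bounded_linear)
    show ?thesis
      by (subst euclidean_representation[of "X p", symmetric]) (simp only: sum scale)
  qed
  then have "deriv_along X f
      = (\<lambda>p. \<Sum>b\<in>Basis. (X p \<bullet> b) *\<^sub>R frechet_derivative f (at p) b)"
    by (simp add: deriv_along_def fun_eq_iff)
  then show ?thesis
    by (simp only:) (intro smooth_sum smooth_scaleR smooth_inner smooth_frechet smooth_const assms)
qed

section \<open>Differentiation rules along vector fields\<close>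

lemma deriv_along_eqI: "(f has_derivative f') (at p) \<Longrightarrow> deriv_along X f p = f' (X p)"
  unfolding deriv_along_def by (metis frechet_derivative_at)

lemma deriv_along_add:
  "smooth f \<Longrightarrow> smooth g \<Longrightarrow>
    deriv_along X (\<lambda>p. f p + g p) p = deriv_along X f p + deriv_along X g p"
  by (rule deriv_along_eqI[THEN trans, OF has_derivative_add[OF smooth_has_derivative
        smooth_has_derivative]]) (auto simp: deriv_along_def)

lemma deriv_along_diff:
  "smooth f \<Longrightarrow> smooth g \<Longrightarrow>
    deriv_along X (\<lambda>p. f p - g p) p = deriv_along X f p - deriv_along X g p"
  by (rule deriv_along_eqI[THEN trans, OF has_derivative_diff[OF smooth_has_derivative
        smooth_has_derivative]]) (auto simp: deriv_along_def)

lemma deriv_along_bounded_bilinear: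
  "bounded_bilinear h \<Longrightarrow> smooth f \<Longrightarrow> smooth g \<Longrightarrow>
    deriv_along X (\<lambda>p. h (f p) (g p)) p = h (deriv_along X f p) (g p) + h (f p) (deriv_along X g p)"
  by (rule deriv_along_eqI[THEN trans, OF bounded_bilinear.FDERIV[OF _ smooth_has_derivative
        smooth_has_derivative]]) (auto simp: deriv_along_def)

lemma deriv_along_bounded_linear:
  "bounded_linear h \<Longrightarrow> smooth f \<Longrightarrow> deriv_along X (\<lambda>p. h (f p)) p = h (deriv_along X f p)"
  by (rule deriv_along_eqI[THEN trans, OF bounded_linear.has_derivative[OF _
        smooth_has_derivative]]) (auto simp: deriv_along_def)

lemma deriv_along_ident [simp]: "deriv_along X (\<lambda>p. p) p = X p"
  by (simp add: deriv_along_def)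

lemma deriv_along_field_linear:
  assumes "smooth f"
  shows "deriv_along (\<lambda>p. X p + Y p) f p = deriv_along X f p + deriv_along Y f p"
    and "deriv_along (\<lambda>p. c p *\<^sub>R X p) f p = c p *\<^sub>R deriv_along X f p"
proof -
  interpret bounded_linear "frechet_derivative f (at p)"
    using smooth_has_derivative[OF assms] by (rule has_derivative_bounded_linear)
  show "deriv_along (\<lambda>p. X p + Y p) f p = deriv_along X f p + deriv_along Y f p"
    and "deriv_along (\<lambda>p. c p *\<^sub>R X p) f p = c p *\<^sub>R deriv_along X f p"
    by (simp_all add: deriv_along_def add scale)
qed

section \<open>Symmetry of second derivatives and the commutator of fields\<close>

text \<open>Two applications of the mean value theorem, first along \<open>u\<close> and then along
  \<open>v\<close>, express the second difference over a parallelogram through one value of the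
  mixed derivative.\<close>

lemma second_difference_mean_value:
  fixes f :: "'a::real_normed_vector \<Rightarrow> real"
  assumes f: "\<And>p. (f has_derivative f' p) (at p)"
    and g: "\<And>p. ((\<lambda>q. f' q u) has_derivative g p) (at p)"
    and h: "h > 0"
  shows "\<exists>s t. 0 < s \<and> s < h \<and> 0 < t \<and> t < h \<and>
    f (p + h *\<^sub>R u + h *\<^sub>R v) - f (p + h *\<^sub>R u) - f (p + h *\<^sub>R v) + f p
      = h * (h * g (p + s *\<^sub>R u + t *\<^sub>R v) v)"
proof -
  have lin: "linear (f' q)" "linear (g q)" for q
    using f g has_derivative_linear by blast+
  have df: "((\<lambda>s. f (q + s *\<^sub>R u)) has_real_derivative f' (q + s *\<^sub>R u) u) (at s)" for q s
  proof -
    have "((\<lambda>s. f (q + s *\<^sub>R u)) has_derivative (\<lambda>x. f' (q + s *\<^sub>R u) (x *\<^sub>R u))) (at s)"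
      by (rule has_derivative_compose[OF _ f]) (auto intro!: derivative_eq_intros)
    then show ?thesis
      by (simp add: has_field_derivative_def linear_cmul[OF lin(1)] mult_commute_abs)
  qed
  have dg: "((\<lambda>t. f' (q + t *\<^sub>R v) u) has_real_derivative g (q + t *\<^sub>R v) v) (at t)" for q t
  proof -
    have "((\<lambda>t. f' (q + t *\<^sub>R v) u) has_derivative (\<lambda>x. g (q + t *\<^sub>R v) (x *\<^sub>R v))) (at t)"
      by (rule has_derivative_compose[OF _ g]) (auto intro!: derivative_eq_intros)
    then show ?thesis
      by (simp add: has_field_derivative_def linear_cmul[OF lin(2)] mult_commute_abs)
  qed
  \<comment> \<open>The increment of \<open>f\<close> along the side \<open>v\<close>, as a function
    of the displacement along \<open>u\<close>; then \<open>F h - F 0\<close> is the second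
    difference.\<close>
  define F where "F s = f (p + h *\<^sub>R v + s *\<^sub>R u) - f (p + s *\<^sub>R u)" for s
  have "(F has_real_derivative f' (p + h *\<^sub>R v + s *\<^sub>R u) u - f' (p + s *\<^sub>R u) u) (at s)" for s
    unfolding F_def by (intro DERIV_diff df)
  from MVT2[OF h this] obtain s where s: "0 < s" "s < h"
    and Fs: "F h - F 0 = h * (f' (p + h *\<^sub>R v + s *\<^sub>R u) u - f' (p + s *\<^sub>R u) u)"
    by auto
  from MVT2[OF h dg[of "p + s *\<^sub>R u"]] obtain t where t: "0 < t" "t < h"
    and "f' (p + s *\<^sub>R u + h *\<^sub>R v) u - f' (p + s *\<^sub>R u) u = h * g (p + s *\<^sub>R u + t *\<^sub>R v) v"
    by auto
  then have "F h - F 0 = h * (h * g (p + s *\<^sub>R u + t *\<^sub>R v) v)"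
    using Fs by (simp add: algebra_simps)
  then show ?thesis
    using s t by (intro exI[of _ s] exI[of _ t]) (simp add: F_def algebra_simps)
qed

text \<open>The second difference does not change when \<open>u\<close> and \<open>v\<close> are
  exchanged, so the two mixed derivatives agree at suitable points arbitrarily near
  \<open>p\<close>, and continuity carries this to \<open>p\<close>.\<close>

lemma second_derivative_symmetric_real:
  fixes f :: "'a::real_normed_vector \<Rightarrow> real"
  assumes f: "smooth f"
  shows "frechet_derivative (\<lambda>q. frechet_derivative f (at q) u) (at p) v
       = frechet_derivative (\<lambda>q. frechet_derivative f (at q) v) (at p) u"
proof -
  define D where "D u v q = frechet_derivative (\<lambda>q. frechet_derivative f (at q) u) (at q) v" for u v q
  have sm: "smooth (D u v)" for u v
    unfolding D_def[abs_def] by (intro smooth_frechet f)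
  note sd = second_difference_mean_value[OF smooth_has_derivative[OF f]
      smooth_has_derivative[OF smooth_frechet[OF f]], folded D_def]
  have "dist (D u v p) (D v u p) < 2 * e" if e: "e > 0" for e
  proof -
    obtain d1 where d1: "d1 > 0" "\<And>q. dist q p < d1 \<Longrightarrow> dist (D u v q) (D u v p) < e"
      using smooth_continuous_on[OF sm, of UNIV] e unfolding continuous_on_iff by (metis UNIV_I)
    obtain d2 where d2: "d2 > 0" "\<And>q. dist q p < d2 \<Longrightarrow> dist (D v u q) (D v u p) < e"
      using smooth_continuous_on[OF sm, of UNIV] e unfolding continuous_on_iff by (metis UNIV_I)
    \<comment> \<open>Small enough that the whole parallelogram lies in both continuity
      neighbourhoods; the summand 1 keeps the denominator positive and the bound in
      \<open>near\<close> strict.\<close>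
    define h where "h = min d1 d2 / (norm u + norm v + 1)"
    have nz: "norm u + norm v + 1 > 0" by (simp add: add_nonneg_pos)
    have h: "h > 0" "h * (norm u + norm v + 1) = min d1 d2"
      using d1(1) d2(1) nz by (auto simp: h_def)
    have near: "dist (p + s *\<^sub>R x + t *\<^sub>R y) p < min d1 d2"
      if "0 < s" "s < h" "0 < t" "t < h" "norm x + norm y = norm u + norm v" for s t x y
    proof -
      have "dist (p + s *\<^sub>R x + t *\<^sub>R y) p = norm (s *\<^sub>R x + t *\<^sub>R y)"
        by (simp add: dist_norm algebra_simps)
      also have "\<dots> \<le> s * norm x + t * norm y"
        using that by (intro norm_triangle_le) simp
      also have "\<dots> \<le> h * norm x + h * norm y"
        using that by (intro add_mono mult_right_mono) auto
      also have "\<dots> < h * (norm u + norm v + 1)"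
        using h(1) that(5) by (simp flip: distrib_left)
      finally show ?thesis using h(2) by simp
    qed
    obtain s t where st: "0 < s" "s < h" "0 < t" "t < h"
      and 1: "f (p + h *\<^sub>R u + h *\<^sub>R v) - f (p + h *\<^sub>R u) - f (p + h *\<^sub>R v) + f p
        = h * (h * D u v (p + s *\<^sub>R u + t *\<^sub>R v))"
      using sd[OF h(1), of p u v] by blast
    obtain s' t' where st': "0 < s'" "s' < h" "0 < t'" "t' < h"
      and 2: "f (p + h *\<^sub>R v + h *\<^sub>R u) - f (p + h *\<^sub>R v) - f (p + h *\<^sub>R u) + f p
        = h * (h * D v u (p + s' *\<^sub>R v + t' *\<^sub>R u))"
      using sd[OF h(1), of p v u] by blast
    have "f (p + h *\<^sub>R v + h *\<^sub>R u) = f (p + h *\<^sub>R u + h *\<^sub>R v)"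
      by (simp add: algebra_simps)
    with 1 2 have "h * (h * D u v (p + s *\<^sub>R u + t *\<^sub>R v)) = h * (h * D v u (p + s' *\<^sub>R v + t' *\<^sub>R u))"
      by linarith
    then have eq: "D u v (p + s *\<^sub>R u + t *\<^sub>R v) = D v u (p + s' *\<^sub>R v + t' *\<^sub>R u)"
      using h(1) by simp
    have "dist (D u v (p + s *\<^sub>R u + t *\<^sub>R v)) (D u v p) < e"
      using near[OF st refl] by (intro d1(2)) simp
    moreover have "dist (D v u (p + s' *\<^sub>R v + t' *\<^sub>R u)) (D v u p) < e"
      using near[OF st', of v u] by (intro d2(2)) simp
    ultimately show ?thesis
      unfolding eq using dist_triangle3 by (smt (verit))
  qed
  \<comment> \<open>With \<open>e\<close> half the distance, the bound would read that the distance
    is less than itself.\<close>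
  from this[of "dist (D u v p) (D v u p) / 2"] have "D u v p = D v u p"
    by (cases "D u v p = D v u p") auto
  then show ?thesis by (simp add: D_def)
qed

lemma second_derivative_symmetric:
  fixes f :: "'a::real_normed_vector \<Rightarrow> 'b::euclidean_space"
  assumes f: "smooth f"
  shows "frechet_derivative (\<lambda>q. frechet_derivative f (at q) u) (at p) v
       = frechet_derivative (\<lambda>q. frechet_derivative f (at q) v) (at p) u"
proof (rule euclidean_eqI)
  fix b :: 'b
  have comp: "frechet_derivative (\<lambda>q. g q \<bullet> b) (at q) w = frechet_derivative g (at q) w \<bullet> b"
    if "smooth g" for g :: "'a \<Rightarrow> 'b" and q w
    using frechet_derivative_at[OF bounded_linear.has_derivative[OF bounded_linear_inner_left
          smooth_has_derivative[OF that]]] by metis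
  have "smooth (\<lambda>q. f q \<bullet> b)"
    by (intro smooth_inner f smooth_const)
  from second_derivative_symmetric_real[OF this]
  show "frechet_derivative (\<lambda>q. frechet_derivative f (at q) u) (at p) v \<bullet> b
      = frechet_derivative (\<lambda>q. frechet_derivative f (at q) v) (at p) u \<bullet> b"
    by (simp add: comp f smooth_frechet)
qed

text \<open>Two contributions arise: from moving the field \<open>X\<close>, and from moving the
  derivative of \<open>f\<close> with \<open>X\<close> frozen at \<open>p\<close>. The second is a
  second derivative in the directions \<open>X p\<close> and \<open>Y p\<close>, hence symmetric in
  them.\<close>

lemma deriv_along_frechet:
  fixes f :: "'a::euclidean_space \<Rightarrow> 'b::euclidean_space"
  assumes X: "smooth X" and f: "smooth f"
  shows "deriv_along Y (deriv_along X f) p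
    = frechet_derivative f (at p) (deriv_along Y X p)
      + frechet_derivative (\<lambda>q. frechet_derivative f (at q) (X p)) (at p) (Y p)"
proof -
  have lin: "bounded_linear (frechet_derivative f (at q))" for q
    using smooth_has_derivative[OF f] by (rule has_derivative_bounded_linear)
  \<comment> \<open>Turns a derivative in a variable direction into a finite sum of products, to
    which the product rule applies.\<close>
  have expand: "frechet_derivative f (at q) w
      = (\<Sum>b\<in>Basis. (w \<bullet> b) *\<^sub>R frechet_derivative f (at q) b)" for q w
    by (subst euclidean_representation[of w, symmetric])
      (simp only: bounded_linear.linear[OF lin] linear_sum linear_cmul)
  note d = smooth_has_derivative[OF X, of p] smooth_has_derivative[OF smooth_frechet[OF f], where p = p]
  have X_expand: "deriv_along X f = (\<lambda>q. \<Sum>b\<in>Basis. (X q \<bullet> b) *\<^sub>R frechet_derivative f (at q) b)"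
    unfolding deriv_along_def by (rule ext) (rule expand)
  have Xp_expand: "(\<lambda>q. frechet_derivative f (at q) (X p))
      = (\<lambda>q. \<Sum>b\<in>Basis. (X p \<bullet> b) *\<^sub>R frechet_derivative f (at q) b)"
    by (rule ext) (rule expand)
  let ?D2 = "\<lambda>b. frechet_derivative (\<lambda>q. frechet_derivative f (at q) b) (at p)"
  have "(deriv_along X f has_derivative
    (\<lambda>w. \<Sum>b\<in>Basis. (X p \<bullet> b) *\<^sub>R ?D2 b w
      + (frechet_derivative X (at p) w \<bullet> b) *\<^sub>R frechet_derivative f (at p) b)) (at p)"
    unfolding X_expand
    by (intro has_derivative_sum has_derivative_scaleR has_derivative_inner_left d)
  then have 1: "deriv_along Y (deriv_along X f) p = (\<Sum>b\<in>Basis. (X p \<bullet> b) *\<^sub>R ?D2 b (Y p)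
      + (deriv_along Y X p \<bullet> b) *\<^sub>R frechet_derivative f (at p) b)"
    unfolding deriv_along_def[of Y X] by (rule deriv_along_eqI)
  have hd: "((\<lambda>q. frechet_derivative f (at q) (X p)) has_derivative
      (\<lambda>w. \<Sum>b\<in>Basis. (X p \<bullet> b) *\<^sub>R ?D2 b w)) (at p)"
    unfolding Xp_expand by (intro has_derivative_sum has_derivative_scaleR_right d)
  have 2: "?D2 (X p) = (\<lambda>w. \<Sum>b\<in>Basis. (X p \<bullet> b) *\<^sub>R ?D2 b w)"
    by (rule frechet_derivative_at[OF hd, symmetric])
  have 3: "frechet_derivative f (at p) (deriv_along Y X p)
      = (\<Sum>b\<in>Basis. (deriv_along Y X p \<bullet> b) *\<^sub>R frechet_derivative f (at p) b)"
    by (rule expand)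
  show ?thesis
    unfolding 1 2 3 by (simp add: sum.distrib)
qed

lemma deriv_along_commutator:
  fixes f :: "'a::euclidean_space \<Rightarrow> 'b::euclidean_space"
  assumes "smooth X" "smooth Y" and f: "smooth f"
  shows "deriv_along X (deriv_along Y f) p - deriv_along Y (deriv_along X f) p
    = deriv_along (field_bracket X Y) f p"
proof -
  have "linear (frechet_derivative f (at p))"
    using smooth_has_derivative[OF f] by (rule has_derivative_linear)
  then show ?thesis
    using second_derivative_symmetric[OF f, of "X p" p "Y p"]
    by (simp add: deriv_along_frechet assms deriv_along_def[of "field_bracket X Y"]
        field_bracket_def linear_diff)
qed


section \<open>The Levi-Civita connection and traces\<close>

lemma is_levi_civita_torsion_free:
  assumes "is_levi_civita g D" "smooth X" "smooth Y"
  shows "D X Y p - D Y X p = field_bracket X Y p"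
proof -
  have "(\<lambda>p. D X Y p - D Y X p) = field_bracket X Y"
    using assms unfolding is_levi_civita_def by blast
  from fun_cong[OF this, of p] show ?thesis by simp
qed

lemma is_levi_civita_metric:
  assumes "is_levi_civita g D" "smooth X" "smooth Y" "smooth Z"
  shows "deriv_along X (\<lambda>p. g p (Y p) (Z p)) p = g p (D X Y p) (Z p) + g p (Y p) (D X Z p)"
proof -
  have "deriv_along X (\<lambda>p. g p (Y p) (Z p)) = (\<lambda>p. g p (D X Y p) (Z p) + g p (Y p) (D X Z p))"
    using assms unfolding is_levi_civita_def by blast
  from fun_cong[OF this, of p] show ?thesis by simp
qed

text \<open>The difference of two such connections is symmetric in its two fields, as the torsions
  agree, and skew under \<open>g\<close> in the last two of three fields, as both are metric.
  Cycling these two symmetries through three fields forces the difference to vanish.\<close>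

lemma is_levi_civita_unique:
  fixes g :: "'a::euclidean_space \<Rightarrow> 'a \<Rightarrow> 'a \<Rightarrow> real"
  assumes D: "is_levi_civita g D" and D': "is_levi_civita g D'"
    and bil: "\<And>p. bilinear (g p)" and sym: "\<And>p u w. g p u w = g p w u"
    and pos: "\<And>p u. g p u u = 0 \<Longrightarrow> u = 0"
    and X: "smooth X" and Y: "smooth Y"
  shows "D X Y = D' X Y"
proof
  fix p
  define A where "A X Y = D X Y p - D' X Y p" for X Y
  have A_sym: "A X Y = A Y X" if "smooth X" "smooth Y" for X Y
    using is_levi_civita_torsion_free[OF D that] is_levi_civita_torsion_free[OF D' that]
    unfolding A_def by (simp add: algebra_simps)
  have A_skew: "g p (A X Y) (Z p) = - g p (A X Z) (Y p)"
    if "smooth X" "smooth Y" "smooth Z" for X Y Z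
    using is_levi_civita_metric[OF D that, of p] is_levi_civita_metric[OF D' that, of p]
    unfolding A_def bilinear_lsub[OF bil] sym[of p "Y p"] by linarith
  have "g p (A X Y) (Z p) = 0" if Z: "smooth Z" for Z
  proof -
    have "g p (A X Y) (Z p) = - g p (A X Z) (Y p)" by (rule A_skew[OF X Y Z])
    also have "\<dots> = g p (A Y Z) (X p)"
      using A_skew[OF Z X Y] A_sym[OF X Z] A_sym[OF Y Z] by simp
    also have "\<dots> = - g p (A X Y) (Z p)"
      using A_skew[OF Y Z X] A_sym[OF X Y] by simp
    finally show ?thesis by simp
  qed
  \<comment> \<open>The test field is constant with value the difference itself, so that
    definiteness of \<open>g p\<close> applies.\<close>
  from this[OF smooth_const[of "A X Y"]] have "A X Y = 0" by (rule pos)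
  then show "D X Y p = D' X Y p" by (simp add: A_def)
qed

lemma smooth_field_bracket:
  fixes X Y :: "'a::euclidean_space \<Rightarrow> 'a"
  assumes "smooth X" "smooth Y"
  shows "smooth (field_bracket X Y)"
  unfolding field_bracket_def[abs_def] by (intro smooth_diff smooth_deriv_along assms)

section \<open>Traces and contractions over a basis\<close>

text \<open>Both sides are the same double sum of matrix entries. It later moves the Ricci trace
  from the tangent space at \<open>p\<close> to the Lie algebra.\<close>

lemma trace_commute:
  fixes f :: "'a::euclidean_space \<Rightarrow> 'b::euclidean_space" and g :: "'b \<Rightarrow> 'a"
  assumes "linear f" "linear g"
  shows "(\<Sum>b\<in>Basis. f (g b) \<bullet> b) = (\<Sum>a\<in>Basis. g (f a) \<bullet> a)"
proof -
  have f: "f (g b) \<bullet> b = (\<Sum>a\<in>Basis. (g b \<bullet> a) * (f a \<bullet> b))" for b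
    by (subst euclidean_representation[of "g b", symmetric])
      (simp only: linear_sum[OF assms(1)] linear_cmul[OF assms(1)] inner_sum_left inner_scaleR_left)
  have g: "g (f a) \<bullet> a = (\<Sum>b\<in>Basis. (f a \<bullet> b) * (g b \<bullet> a))" for a
    by (subst euclidean_representation[of "f a", symmetric])
      (simp only: linear_sum[OF assms(2)] linear_cmul[OF assms(2)] inner_sum_left inner_scaleR_left)
  show ?thesis
    unfolding f g by (subst sum.swap) (simp add: mult.commute)
qed

lemma sum_Basis_prod:
  "(\<Sum>b\<in>(Basis :: ('a::euclidean_space \<times> 'b::euclidean_space) set). f b)
    = (\<Sum>a\<in>Basis. f (a, 0)) + (\<Sum>b\<in>Basis. f (0, b))"
proof -
  have "inj_on (\<lambda>u. (u::'a, 0::'b)) Basis" "inj_on (\<lambda>u. (0::'a, u::'b)) Basis"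
    by (auto intro!: inj_onI)
  then show ?thesis
    unfolding Basis_prod_def by (subst sum.union_disjoint) (auto simp: Basis_prod_def sum.reindex)
qed

text \<open>Expanding the vectors of each basis in the other gives the same double sum. This frees
  \<open>J_op B j\<close> from the choice of \<open>B\<close>.\<close>

lemma orthonormal_basis_sum:
  fixes h :: "'z::euclidean_space \<Rightarrow> 'z \<Rightarrow> 'b::real_normed_vector"
  assumes B: "orthonormal_basis B" and h: "bilinear h"
  shows "(\<Sum>b\<in>B. h b b) = (\<Sum>c\<in>Basis. h c c)"
proof -
  have fin: "finite B"
    using B by (simp add: orthonormal_basis_def pairwise_orthogonal_imp_finite)
  have ip: "b \<bullet> b' = (if b = b' then 1 else 0)" if "b \<in> B" "b' \<in> B" for b b'
    using B that by (auto simp: orthonormal_basis_def pairwise_def orthogonal_def norm_eq_1)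
  \<comment> \<open>The identity is linear in \<open>x\<close> and holds on \<open>B\<close> by
    orthonormality, hence on the span, which is everything.\<close>
  have expand: "(\<Sum>b\<in>B. (x \<bullet> b) *\<^sub>R b) = x" for x
  proof -
    have "x \<in> span B" using B by (simp add: orthonormal_basis_def)
    then show ?thesis
    proof (induction rule: span_induct_alt)
      case base
      then show ?case by simp
    next
      case (step c b y)
      have "(\<Sum>b'\<in>B. (b \<bullet> b') *\<^sub>R b') = b"
        using step fin by (simp add: ip if_distrib[of "\<lambda>r. r *\<^sub>R _"] cong: if_cong)
      then show ?case
        using step by (simp add: inner_add_left scaleR_add_left sum.distrib flip: scaleR_scaleR scaleR_sum_right)
    qed
  qed
  have hl: "linear (\<lambda>x. h x y)" and hr: "linear (h x)" for x y
    using h by (auto simp: bilinear_def)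
  have "(\<Sum>c\<in>Basis. h c c) = (\<Sum>c\<in>Basis. \<Sum>b\<in>B. (c \<bullet> b) *\<^sub>R h b c)"
  proof (rule sum.cong[OF refl])
    fix c :: 'z
    have "h c c = h (\<Sum>b\<in>B. (c \<bullet> b) *\<^sub>R b) c" by (simp add: expand)
    also have "\<dots> = (\<Sum>b\<in>B. (c \<bullet> b) *\<^sub>R h b c)"
      by (simp add: linear_sum[OF hl] linear_cmul[OF hl])
    finally show "h c c = (\<Sum>b\<in>B. (c \<bullet> b) *\<^sub>R h b c)" .
  qed
  also have "\<dots> = (\<Sum>b\<in>B. \<Sum>c\<in>Basis. (b \<bullet> c) *\<^sub>R h b c)"
    by (subst sum.swap) (simp add: inner_commute)
  also have "\<dots> = (\<Sum>b\<in>B. h b b)"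
  proof (rule sum.cong[OF refl])
    fix b :: 'z
    have "h b b = h b (\<Sum>c\<in>Basis. (b \<bullet> c) *\<^sub>R c)" by (simp add: euclidean_representation)
    also have "\<dots> = (\<Sum>c\<in>Basis. (b \<bullet> c) *\<^sub>R h b c)"
      by (simp only: linear_sum[OF hr] linear_cmul[OF hr])
    finally show "(\<Sum>c\<in>Basis. (b \<bullet> c) *\<^sub>R h b c) = h b b" by simp
  qed
  finally show ?thesis by simp
qed

section \<open>Left-invariant geometry of \<open>N(j)\<close>\<close>

locale two_step_nilpotent =
  fixes j :: "'z::euclidean_space \<Rightarrow> 'v::euclidean_space \<Rightarrow>\<^sub>L 'v"
  assumes lin_j: "linear j" and skew_j: "range j \<subseteq> so"
begin

abbreviation brk :: "'v \<times> 'z \<Rightarrow> 'v \<times> 'z \<Rightarrow> 'v \<times> 'z" where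
  "brk \<equiv> nil_bracket j"

text \<open>\<open>frame p\<close> is the differential at \<open>0\<close> of the left translation by \<open>p\<close>; its inverse \<open>coframe p\<close> is the
  differential at \<open>p\<close> of the left translation by \<open>- p\<close>.\<close>

definition frame :: "'v \<times> 'z \<Rightarrow> 'v \<times> 'z \<Rightarrow> 'v \<times> 'z" where
  "frame p u = u + (1/2) *\<^sub>R brk p u"

definition coframe :: "'v \<times> 'z \<Rightarrow> 'v \<times> 'z \<Rightarrow> 'v \<times> 'z" where
  "coframe p w = w - (1/2) *\<^sub>R brk p w"

text \<open>In Koszul's formula the two terms with the bracket transposed become \<open>j\<close>
  terms, because \<open>j\<close> is dual to the bracket.\<close>

definition conn :: "'v \<times> 'z \<Rightarrow> 'v \<times> 'z \<Rightarrow> 'v \<times> 'z" where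
  "conn u w = (1/2) *\<^sub>R (brk u w - (j (snd u) (fst w) + j (snd w) (fst u), 0))"

definition hat :: "('v \<times> 'z \<Rightarrow> 'v \<times> 'z) \<Rightarrow> 'v \<times> 'z \<Rightarrow> 'v \<times> 'z" where
  "hat X p = coframe p (X p)"

definition nabla :: "('v \<times> 'z \<Rightarrow> 'v \<times> 'z) \<Rightarrow> ('v \<times> 'z \<Rightarrow> 'v \<times> 'z) \<Rightarrow> 'v \<times> 'z \<Rightarrow> 'v \<times> 'z" where
  "nabla X Y p = frame p (deriv_along X (hat Y) p + conn (hat X p) (hat Y p))"

definition curv :: "'v \<times> 'z \<Rightarrow> 'v \<times> 'z \<Rightarrow> 'v \<times> 'z \<Rightarrow> 'v \<times> 'z" where
  "curv u v w = conn u (conn v w) - conn v (conn u w) - conn (brk u v) w"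

definition ric :: "'v \<times> 'z \<Rightarrow> 'v \<times> 'z \<Rightarrow> real" where
  "ric u w = (\<Sum>b\<in>Basis. curv b u w \<bullet> b)"

section \<open>Algebra of the bracket and the connection form\<close>

lemmas brk_linear = nil_bracket_bilinear[OF lin_j]
lemmas brk_2_step = nil_bracket_2_step[OF lin_j]
lemmas brk_skew = nil_bracket_skew[OF lin_j skew_j]
lemmas j_linear = linear_add[OF lin_j] linear_cmul[OF lin_j] linear_0[OF lin_j]

lemma j_skew: "j Z x \<bullet> y = - (j Z y \<bullet> x)"
  using skew_j by (auto simp: so_def inner_commute)

lemma fst_brk: "fst (brk u w) = 0"
  by (rule nil_bracket_char[OF lin_j])

lemma snd_brk_inner: "snd (brk u w) \<bullet> Z = j Z (fst u) \<bullet> fst w"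
  using nil_bracket_char(2)[OF lin_j, of u w Z] by (simp add: inner_prod_def)

lemma bilinear_brk: "bilinear brk"
  by (simp add: bilinear_def linear_iff brk_linear)

lemma bounded_bilinear_brk: "bounded_bilinear brk"
  using bilinear_brk bilinear_conv_bounded_bilinear by blast

lemmas brk_diff = bilinear_lsub[OF bilinear_brk] bilinear_rsub[OF bilinear_brk]
lemmas brk_zero = bilinear_lzero[OF bilinear_brk] bilinear_rzero[OF bilinear_brk]

lemma bilinear_conn: "bilinear conn"
  unfolding bilinear_def linear_iff conn_def
  by (simp add: brk_linear j_linear blinfun.bilinear_simps algebra_simps)

lemma bounded_bilinear_conn: "bounded_bilinear conn"
  using bilinear_conn bilinear_conv_bounded_bilinear by blast

lemmas conn_linear = bilinear_ladd[OF bilinear_conn] bilinear_radd[OF bilinear_conn]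
  bilinear_lmul[OF bilinear_conn] bilinear_rmul[OF bilinear_conn]
  bilinear_lsub[OF bilinear_conn] bilinear_rsub[OF bilinear_conn]

lemma conn_torsion: "conn u w - conn w u = brk u w"
proof -
  have "conn u w - conn w u = (1/2) *\<^sub>R (brk u w - brk w u)"
    by (simp add: conn_def algebra_simps)
  also have "\<dots> = brk u w"
    unfolding brk_skew[of w u] by (simp flip: scaleR_2)
  finally show ?thesis .
qed

lemma conn_inner:
  "conn u w \<bullet> y = (j (snd y) (fst u) \<bullet> fst w - j (snd u) (fst w) \<bullet> fst y - j (snd w) (fst u) \<bullet> fst y) / 2"
  by (simp add: conn_def inner_prod_def fst_brk snd_brk_inner inner_diff_left inner_add_left algebra_simps
      diff_divide_distrib)

text \<open>When \<open>w\<close> and \<open>y\<close> are exchanged, the outer terms of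
  \<open>conn_inner\<close> trade places with opposite signs, and the middle one changes sign
  because \<open>j\<close> is skew. This is metric compatibility at the Lie algebra level.\<close>

lemma conn_skew: "conn u w \<bullet> y = - (w \<bullet> conn u y)"
  using j_skew[of "snd u" "fst w" "fst y"]
  by (simp add: inner_commute[of w] conn_inner field_simps)

section \<open>Passing between vector fields and Lie algebra valued functions\<close>

text \<open>\<open>coframe p\<close> changes a vector only by a bracket, and brackets are
  central.\<close>

lemma brk_coframe: "brk (coframe p u) w = brk u w" "brk u (coframe p w) = brk u w"
  by (simp_all add: coframe_def brk_diff brk_linear brk_2_step)

lemma frame_coframe: "frame p (coframe p w) = w"
  by (simp add: frame_def brk_coframe) (simp add: coframe_def)

lemma coframe_frame: "coframe p (frame p u) = u"
  by (simp add: coframe_def frame_def brk_linear brk_2_step)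

lemma linear_frame: "linear (frame p)" and linear_coframe: "linear (coframe p)"
  by (auto simp: linear_iff frame_def coframe_def brk_linear algebra_simps)

lemmas frame_linear = linear_add[OF linear_frame] linear_cmul[OF linear_frame] linear_diff[OF linear_frame]
lemmas coframe_linear =
  linear_add[OF linear_coframe] linear_cmul[OF linear_coframe] linear_diff[OF linear_coframe]

lemma nil_metric_coframe: "nil_metric j p u w = coframe p u \<bullet> coframe p w"
  using bilinear_lneg[OF bilinear_brk, of p]
  by (simp add: nil_metric_def nil_mult_frechet[OF lin_j] coframe_def)

lemma smooth_frame: "smooth X \<Longrightarrow> smooth (\<lambda>p. frame p (X p))"
  unfolding frame_def
  by (intro smooth_add smooth_scaleR smooth_bounded_bilinear[OF bounded_bilinear_brk]
      smooth_const smooth_ident)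

lemma smooth_hat: "smooth X \<Longrightarrow> smooth (hat X)"
  unfolding hat_def[abs_def] coframe_def
  by (intro smooth_diff smooth_scaleR smooth_bounded_bilinear[OF bounded_bilinear_brk]
      smooth_const smooth_ident)

lemma deriv_along_brk:
  "smooth f \<Longrightarrow> smooth g \<Longrightarrow>
    deriv_along X (\<lambda>p. brk (f p) (g p)) p = brk (deriv_along X f p) (g p) + brk (f p) (deriv_along X g p)"
  by (rule deriv_along_bounded_bilinear[OF bounded_bilinear_brk])

lemma deriv_along_conn:
  "smooth f \<Longrightarrow> smooth g \<Longrightarrow>
    deriv_along X (\<lambda>p. conn (f p) (g p)) p = conn (deriv_along X f p) (g p) + conn (f p) (deriv_along X g p)"
  by (rule deriv_along_bounded_bilinear[OF bounded_bilinear_conn])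

text \<open>The correction term comes from the dependence of \<open>coframe p\<close> itself on
  \<open>p\<close>.\<close>

lemma deriv_along_hat:
  assumes "smooth Y"
  shows "deriv_along X (hat Y) p = coframe p (deriv_along X Y p) - (1/2) *\<^sub>R brk (X p) (Y p)"
proof -
  have s: "smooth (\<lambda>p. brk p (Y p))"
    by (intro smooth_bounded_bilinear[OF bounded_bilinear_brk] smooth_ident assms)
  then have "deriv_along X (hat Y) p
      = deriv_along X Y p - (1/2) *\<^sub>R (brk (X p) (Y p) + brk p (deriv_along X Y p))"
    unfolding hat_def[abs_def] coframe_def
    using assms deriv_along_brk[OF smooth_ident assms, of X p]
      deriv_along_bounded_linear[OF bounded_linear_scaleR_right s, of X "1/2" p]
    by (simp add: deriv_along_diff smooth_scaleR smooth_const)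
  then show ?thesis by (simp add: coframe_def algebra_simps)
qed

text \<open>This is the Maurer-Cartan equation: the two half brackets from
  \<open>deriv_along_hat\<close> add up to a full one by skewness.\<close>

lemma hat_field_bracket:
  assumes "smooth X" "smooth Y"
  shows "hat (field_bracket X Y) p
    = deriv_along X (hat Y) p - deriv_along Y (hat X) p + brk (hat X p) (hat Y p)"
proof -
  have b: "brk (hat X p) (hat Y p) = (1/2) *\<^sub>R brk (X p) (Y p) - (1/2) *\<^sub>R brk (Y p) (X p)"
    unfolding hat_def brk_coframe brk_skew[of "Y p" "X p"] by (simp flip: scaleR_left_distrib)
  show ?thesis
    unfolding b by (simp add: hat_def field_bracket_def coframe_linear deriv_along_hat[OF assms(1)]
      deriv_along_hat[OF assms(2)])
qed

lemma hat_nabla: "hat (nabla X Y) p = deriv_along X (hat Y) p + conn (hat X p) (hat Y p)"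
  by (simp add: hat_def[of "nabla X Y"] nabla_def coframe_frame)

lemma hat_inject: "hat X p = hat Y p \<longleftrightarrow> X p = Y p"
  unfolding hat_def by (metis frame_coframe)

section \<open>The Levi-Civita connection of the left-invariant metric\<close>

lemma smooth_nabla:
  assumes "smooth X" "smooth Y"
  shows "smooth (nabla X Y)"
  unfolding nabla_def[abs_def]
  by (intro smooth_frame smooth_add smooth_deriv_along smooth_hat assms
      smooth_bounded_bilinear[OF bounded_bilinear_conn])

lemma hat_linear:
  "hat (\<lambda>p. X p + Y p) = (\<lambda>p. hat X p + hat Y p)"
  "hat (\<lambda>p. c p *\<^sub>R X p) = (\<lambda>p. c p *\<^sub>R hat X p)"
  by (simp_all add: fun_eq_iff hat_def coframe_linear)

lemma nabla_is_levi_civita: "is_levi_civita (nil_metric j) nabla"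
  unfolding is_levi_civita_def
proof (intro conjI allI impI ext)
  fix X Y :: "'v \<times> 'z \<Rightarrow> 'v \<times> 'z" assume X: "smooth X" and Y: "smooth Y"
  show "smooth (nabla X Y)" using X Y by (rule smooth_nabla)
  fix p
  show "nabla X Y p - nabla Y X p = field_bracket X Y p"
    unfolding hat_inject[of "\<lambda>p. nabla X Y p - nabla Y X p" p "field_bracket X Y", symmetric]
      hat_field_bracket[OF X Y] conn_torsion[symmetric]
    using hat_nabla[of X Y p] hat_nabla[of Y X p]
    by (simp add: hat_def coframe_linear)
  fix Z :: "'v \<times> 'z \<Rightarrow> 'v \<times> 'z"
  {
    assume Z: "smooth Z"
    show "nabla (\<lambda>p. X p + Y p) Z p = nabla X Z p + nabla Y Z p"
      by (simp add: nabla_def hat_linear deriv_along_field_linear smooth_hat[OF Z] conn_linear frame_linear)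
    show "nabla X (\<lambda>p. Y p + Z p) p = nabla X Y p + nabla X Z p"
      by (simp add: nabla_def hat_linear deriv_along_add smooth_hat[OF Y] smooth_hat[OF Z]
          conn_linear frame_linear)
    \<comment> \<open>Through \<open>hat\<close> the metric is a constant inner product, so only
      derivative terms appear here; the \<open>conn\<close> parts of the two covariant derivatives
      cancel by \<open>conn_skew\<close>.\<close>
    have "deriv_along X (\<lambda>p. hat Y p \<bullet> hat Z p) p
        = deriv_along X (hat Y) p \<bullet> hat Z p + hat Y p \<bullet> deriv_along X (hat Z) p"
      by (intro deriv_along_bounded_bilinear bounded_bilinear_inner smooth_hat Y Z)
    then show "deriv_along X (\<lambda>p. nil_metric j p (Y p) (Z p)) p
        = nil_metric j p (nabla X Y p) (Z p) + nil_metric j p (Y p) (nabla X Z p)"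
      using conn_skew[of "hat X p" "hat Y p" "hat Z p"]
      by (simp add: nil_metric_coframe nabla_def coframe_frame inner_add_left inner_add_right flip: hat_def)
  }
  fix f :: "'v \<times> 'z \<Rightarrow> real" assume f: "smooth f"
  show "nabla (\<lambda>p. f p *\<^sub>R X p) Y p = f p *\<^sub>R nabla X Y p"
    by (simp add: nabla_def hat_linear deriv_along_field_linear smooth_hat[OF Y] conn_linear frame_linear
        flip: scaleR_add_right)
  have "deriv_along X (\<lambda>p. f p *\<^sub>R hat Y p) p
      = deriv_along X f p *\<^sub>R hat Y p + f p *\<^sub>R deriv_along X (hat Y) p"
    by (intro deriv_along_bounded_bilinear bounded_bilinear_scaleR smooth_hat Y f)
  then show "nabla X (\<lambda>p. f p *\<^sub>R Y p) p = deriv_along X f p *\<^sub>R Y p + f p *\<^sub>R nabla X Y p"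
    by (simp add: nabla_def hat_linear conn_linear frame_linear scaleR_add_right)
      (simp add: hat_def frame_coframe)
qed

text \<open>\<open>levi_civita\<close> is a choice; \<open>nabla\<close> witnesses that the choice
  succeeds, and uniqueness identifies the two on smooth fields.\<close>

lemma levi_civita_nabla:
  assumes "smooth X" "smooth Y"
  shows "levi_civita (nil_metric j) X Y = nabla X Y"
proof (rule is_levi_civita_unique[OF _ nabla_is_levi_civita _ _ _ assms])
  show "is_levi_civita (nil_metric j) (levi_civita (nil_metric j))"
    unfolding levi_civita_def using nabla_is_levi_civita by (rule someI[where P = "is_levi_civita (nil_metric j)"])
  show "bilinear (nil_metric j p)" for p
    by (auto simp: bilinear_def linear_iff nil_metric_coframe coframe_linear inner_add_left inner_add_right)
  show "nil_metric j p u w = nil_metric j p w u" for p u w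
    by (simp add: nil_metric_coframe inner_commute)
  show "u = 0" if "nil_metric j p u u = 0" for p u
    using that frame_coframe[of p u] by (simp add: nil_metric_coframe linear_0[OF linear_frame])
qed

section \<open>Curvature and Ricci tensor as constant forms\<close>

text \<open>Separates the terms for the curvature: the two that pair an undifferentiated
  \<open>hat X\<close> or \<open>hat Y\<close> with a first derivative of \<open>hat Z\<close> are
  together symmetric in \<open>X\<close> and \<open>Y\<close>, so they cancel there.\<close>

lemma hat_nabla_nabla:
  assumes "smooth X" "smooth Y" "smooth Z"
  shows "hat (nabla X (nabla Y Z)) p
    = deriv_along X (deriv_along Y (hat Z)) p
      + conn (deriv_along X (hat Y) p) (hat Z p) + conn (hat Y p) (deriv_along X (hat Z) p)
      + conn (hat X p) (deriv_along Y (hat Z) p) + conn (hat X p) (conn (hat Y p) (hat Z p))"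
proof -
  have eq: "hat (nabla Y Z) = (\<lambda>p. deriv_along Y (hat Z) p + conn (hat Y p) (hat Z p))"
    by (simp add: fun_eq_iff hat_nabla)
  have s: "smooth (hat X)" "smooth (hat Y)" "smooth (hat Z)" "smooth (deriv_along Y (hat Z))"
    by (intro smooth_hat smooth_deriv_along assms)+
  show ?thesis
    unfolding hat_nabla[of X] eq
    by (subst deriv_along_add)
      (auto intro!: s smooth_bounded_bilinear[OF bounded_bilinear_conn] simp: deriv_along_conn s conn_linear)
qed

text \<open>Second derivatives of \<open>hat Z\<close> cancel against the derivative along the field
  bracket. By \<open>hat_field_bracket\<close>, the first-order terms in \<open>hat X\<close> and
  \<open>hat Y\<close> leave minus their bracket, which gives the last term of
  \<open>curv\<close>.\<close>

lemma riemann_curv: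
  assumes X: "smooth X" and Y: "smooth Y" and Z: "smooth Z"
  shows "riemann (nil_metric j) X Y Z p = frame p (curv (hat X p) (hat Y p) (hat Z p))"
proof -
  define W where "W = field_bracket X Y"
  have W: "smooth W" unfolding W_def by (intro smooth_field_bracket X Y)
  have "coframe p (riemann (nil_metric j) X Y Z p)
      = hat (nabla X (nabla Y Z)) p - hat (nabla Y (nabla X Z)) p - hat (nabla W Z) p"
    by (simp add: riemann_def Let_def levi_civita_nabla smooth_nabla X Y Z W coframe_linear hat_def
        flip: W_def)
  also have "\<dots> = deriv_along X (deriv_along Y (hat Z)) p - deriv_along Y (deriv_along X (hat Z)) p
      - deriv_along W (hat Z) p
      + conn (deriv_along X (hat Y) p - deriv_along Y (hat X) p - hat W p) (hat Z p)
      + conn (hat X p) (conn (hat Y p) (hat Z p)) - conn (hat Y p) (conn (hat X p) (hat Z p))"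
    unfolding hat_nabla_nabla[OF X Y Z] hat_nabla_nabla[OF Y X Z] hat_nabla[of W] conn_linear
    by (simp add: algebra_simps)
  also have "\<dots> = curv (hat X p) (hat Y p) (hat Z p)"
    unfolding W_def deriv_along_commutator[OF X Y smooth_hat[OF Z]] hat_field_bracket[OF X Y] curv_def
    using bilinear_lneg[OF bilinear_conn, of "brk (hat X p) (hat Y p)" "hat Z p"] by simp
  finally show ?thesis by (metis frame_coframe)
qed

lemma ricci_ric:
  assumes Y: "smooth Y" and Z: "smooth Z"
  shows "ricci (nil_metric j) Y Z p = ric (hat Y p) (hat Z p)"
proof -
  have lin: "linear (\<lambda>u. curv u (hat Y p) (hat Z p))"
    by (simp add: linear_iff curv_def conn_linear brk_linear algebra_simps)
  then have lin': "linear (\<lambda>u. frame p (curv u (hat Y p) (hat Z p)))"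
    using linear_compose[OF lin linear_frame] by (simp add: o_def)
  have "ricci (nil_metric j) Y Z p
      = (\<Sum>b\<in>Basis. frame p (curv (coframe p b) (hat Y p) (hat Z p)) \<bullet> b)"
    by (simp add: ricci_def riemann_curv smooth_const Y Z hat_def[of "\<lambda>_. _"])
  \<comment> \<open>The curvature endomorphism at \<open>p\<close> is a conjugate by
    \<open>frame p\<close> of the one at the neutral element, so the traces agree.\<close>
  also have "\<dots> = (\<Sum>b\<in>Basis. coframe p (frame p (curv b (hat Y p) (hat Z p))) \<bullet> b)"
    by (rule trace_commute[OF lin' linear_coframe])
  also have "\<dots> = ric (hat Y p) (hat Z p)"
    by (simp add: coframe_frame ric_def)
  finally show ?thesis .
qed

lemma bounded_bilinear_ric: "bounded_bilinear ric"
proof -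
  have "bilinear ric"
    by (auto simp: bilinear_def linear_iff ric_def curv_def conn_linear brk_linear inner_diff_left
        inner_add_left sum.distrib sum_subtractf sum_distrib_left algebra_simps)
  then show ?thesis
    using bilinear_conv_bounded_bilinear by blast
qed

lemma nabla_ricci_ric:
  assumes X: "smooth X"
  shows "nabla_ricci (nil_metric j) X X X p
    = - ric (conn (hat X p) (hat X p)) (hat X p) - ric (hat X p) (conn (hat X p) (hat X p))"
proof -
  interpret ric: bounded_bilinear ric by (rule bounded_bilinear_ric)
  have "ricci (nil_metric j) X X = (\<lambda>p. ric (hat X p) (hat X p))"
    by (simp add: fun_eq_iff ricci_ric X)
  then show ?thesis
    by (simp add: nabla_ricci_def levi_civita_nabla X ricci_ric smooth_nabla hat_nabla ric.add_left
        ric.add_right deriv_along_bounded_bilinear[OF bounded_bilinear_ric] smooth_hat)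
qed

lemma type_A_iff_ric:
  "type_A (nil_metric j) \<longleftrightarrow> (\<forall>u. ric (conn u u) u + ric u (conn u u) = 0)"
proof
  assume A: "type_A (nil_metric j)"
  show "\<forall>u. ric (conn u u) u + ric u (conn u u) = 0"
  proof
    fix u
    \<comment> \<open>At the neutral element \<open>coframe\<close> is the identity, so constant
      fields realise every vector of the Lie algebra.\<close>
    have "hat (\<lambda>_. u) 0 = u" by (simp add: hat_def coframe_def brk_zero)
    moreover have "nabla_ricci (nil_metric j) (\<lambda>_. u) (\<lambda>_. u) (\<lambda>_. u) 0 = 0"
      using A smooth_const unfolding type_A_def by blast
    ultimately show "ric (conn u u) u + ric u (conn u u) = 0"
      using nabla_ricci_ric[OF smooth_const, of u 0] by simp
  qed
next
  assume R: "\<forall>u. ric (conn u u) u + ric u (conn u u) = 0"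
  have "nabla_ricci (nil_metric j) X X X p = 0" if "smooth X" for X p
    using nabla_ricci_ric[OF that, of p] R[rule_format, of "hat X p"] by linarith
  then show "type_A (nil_metric j)"
    unfolding type_A_def by blast
qed

section \<open>Evaluation of the Ricci form and comparison with \<open>J_op\<close>\<close>

lemma brk_inner_brk:
  "snd (brk u w) \<bullet> snd (brk u' w')
    = (\<Sum>f\<in>Basis. (j f (fst u) \<bullet> fst w) * (j f (fst u') \<bullet> fst w'))"
  by (subst euclidean_inner) (simp only: snd_brk_inner)

text \<open>Expanding the inner products over the other factor's basis turns both sides into the
  same double sum. It lets the two parts of the Ricci trace be added.\<close>

lemma sum_brk_inner_brk:
  "(\<Sum>e\<in>Basis. snd (brk u (e, 0)) \<bullet> snd (brk w (e, 0)))
    = (\<Sum>f\<in>Basis. j f (fst u) \<bullet> j f (fst w))"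
proof -
  have "j f (fst u) \<bullet> j f (fst w) = (\<Sum>e\<in>Basis. (j f (fst u) \<bullet> e) * (j f (fst w) \<bullet> e))" for f
    by (rule euclidean_inner)
  then show ?thesis
    by (simp add: brk_inner_brk sum.swap[of _ _ "Basis :: 'z set"])
qed

text \<open>Skewness of \<open>conn\<close> moves the outer operators onto \<open>b\<close>. By
  \<open>conn_self\<close> the assumption holds for basis vectors lying in one factor.\<close>

lemma curv_trace_term:
  assumes "conn b b = 0"
  shows "curv b u w \<bullet> b = conn b w \<bullet> conn u b - conn (brk b u) w \<bullet> b"
  using conn_skew[of b "conn u w" b] conn_skew[of u "conn b w" b] assms
  by (simp add: curv_def inner_diff_left)

lemma conn_self: "conn (x, z) (x, z) = (- j z x, 0)"
  using nil_bracket_self[OF lin_j skew_j, of "(x, z)"]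
  by (simp add: conn_def zero_prod_def flip: scaleR_2)

text \<open>The assumption removes the product of \<open>j (snd u) e\<close> and
  \<open>j (snd w) e\<close>, which is the part of the Ricci form on the center. Basis vectors of
  \<open>'v\<close> then contribute the factor -3/4 and those of \<open>'z\<close> the factor
  1/4.\<close>

lemma ric_eq:
  assumes "snd u = 0 \<or> snd w = 0"
  shows "ric u w = - (1/2) * (\<Sum>f\<in>Basis. j f (fst u) \<bullet> j f (fst w))"
proof -
  \<comment> \<open>The product of connection terms gives -1/4, and the term with
    \<open>brk (e, 0) u\<close> gives another -1/2.\<close>
  have v: "curv (e, 0) u w \<bullet> (e, 0) = - (3/4) * (snd (brk u (e, 0)) \<bullet> snd (brk w (e, 0)))" for e
  proof -
    have 1: "conn (e, 0) w = (1/2) *\<^sub>R (- j (snd w) e, - snd (brk w (e, 0)))"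
      using brk_skew[of "(e, 0)" w] fst_brk[of w "(e, 0)"]
      by (simp add: conn_def j_linear prod_eq_iff)
    have 2: "conn u (e, 0) = (1/2) *\<^sub>R (- j (snd u) e, snd (brk u (e, 0)))"
      using fst_brk[of u "(e, 0)"] by (simp add: conn_def j_linear prod_eq_iff)
    have 3: "conn (brk (e, 0) u) w \<bullet> (e, 0) = (1/2) * (snd (brk u (e, 0)) \<bullet> snd (brk w (e, 0)))"
    proof -
      have "conn (brk (e, 0) u) w \<bullet> (e, 0) = - (1/2) * (j (snd (brk (e, 0) u)) (fst w) \<bullet> e)"
        by (simp add: conn_inner fst_brk j_linear)
      also have "\<dots> = - (1/2) * (snd (brk w (e, 0)) \<bullet> snd (brk (e, 0) u))"
        by (simp add: snd_brk_inner)
      also have "\<dots> = (1/2) * (snd (brk u (e, 0)) \<bullet> snd (brk w (e, 0)))"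
        unfolding brk_skew[of "(e, 0)" u] by (simp add: inner_commute)
      finally show ?thesis .
    qed
    have 0: "conn (e, 0) (e, 0) = 0" by (simp add: conn_self j_linear zero_prod_def)
    show ?thesis
      using assms unfolding curv_trace_term[OF 0] 3 1 2
      by (auto simp: j_linear inner_prod_def inner_commute)
  qed
  have z: "curv (0, f) u w \<bullet> (0, f) = (1/4) * (j f (fst u) \<bullet> j f (fst w))" for f
  proof -
    have brk0: "brk (0, f) y = 0" "brk y (0, f) = 0" for y
      by (simp_all add: nil_bracket_explicit[OF lin_j] zero_prod_def)
    have 0: "conn (0, f) (0, f) = 0" by (simp add: conn_self zero_prod_def)
    show ?thesis
      unfolding curv_trace_term[OF 0] by (simp add: brk0 bilinear_lzero[OF bilinear_conn])
        (simp add: conn_def brk0 inner_prod_def inner_commute)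
  qed
  show ?thesis
    unfolding ric_def sum_Basis_prod v z
    by (simp add: sum_brk_inner_brk sum_negf flip: sum_distrib_left sum_divide_distrib)
qed

text \<open>The contraction may run over \<open>B\<close> instead of \<open>Basis\<close>, and
  moving one \<open>j b\<close> across the inner product produces the sign.\<close>

lemma sum_inner_J_op:
  assumes "orthonormal_basis B"
  shows "(\<Sum>f\<in>Basis. j f x \<bullet> j f y) = - (J_op B j x \<bullet> y)"
proof -
  have "bilinear (\<lambda>a b. j a x \<bullet> j b y)"
    by (auto simp: bilinear_def linear_iff j_linear blinfun.bilinear_simps inner_add_left inner_add_right)
  from orthonormal_basis_sum[OF assms this]
  have "(\<Sum>f\<in>Basis. j f x \<bullet> j f y) = (\<Sum>b\<in>B. j b x \<bullet> j b y)" by simp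
  also have "\<dots> = - (J_op B j x \<bullet> y)"
  proof -
    have "j b (j b x) \<bullet> y = - (j b x \<bullet> j b y)" for b
      using j_skew[of b "j b x" y] by (simp add: inner_commute)
    then show ?thesis
      by (simp add: J_op_def blinfun.sum_left inner_sum_left sum_negf)
  qed
  finally show ?thesis .
qed

lemma type_A_iff_J_op:
  assumes "orthonormal_basis B"
  shows "type_A (nil_metric j) \<longleftrightarrow> (\<forall>z x. J_op B j (j z x) \<bullet> x = 0)"
proof -
  \<comment> \<open>\<open>conn_self\<close> has second component 0, so \<open>ric_eq\<close>
    applies in either order of the arguments and each term contributes one half.\<close>
  have "ric (conn (x, z) (x, z)) (x, z) + ric (x, z) (conn (x, z) (x, z)) = - (J_op B j (j z x) \<bullet> x)"
    for x z
    using sum_inner_J_op[OF assms, of "j z x" x]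
    by (simp add: conn_self ric_eq inner_commute[of _ "blinfun_apply _ (blinfun_apply _ _)"]
        blinfun.minus_right sum_negf)
  then show ?thesis by (auto simp: type_A_iff_ric)
qed

end

lemma so_iff_inner_self: "A \<in> so \<longleftrightarrow> (\<forall>x. A x \<bullet> x = 0)"
proof
  assume A: "A \<in> so"
  have "A x \<bullet> x = - (x \<bullet> A x)" for x using A unfolding so_def by blast
  then show "\<forall>x. A x \<bullet> x = 0" by (simp add: inner_commute)
next
  assume A: "\<forall>x. A x \<bullet> x = 0"
  have "A x \<bullet> y = - (x \<bullet> A y)" for x y
    \<comment> \<open>Polarization: the diagonal terms vanish, leaving the sum of the two cross
      terms.\<close>
    using A[rule_format, of "x + y"] A[rule_format, of x] A[rule_format, of y]
    by (simp add: blinfun.bilinear_simps inner_add_left inner_add_right inner_commute)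
  then show "A \<in> so" by (simp add: so_def)
qed

theorem theorem1p2:
  fixes j :: "'z::euclidean_space \<Rightarrow> 'v::euclidean_space \<Rightarrow>\<^sub>L 'v"
    and B :: "'z set"
  assumes "linear j"
    and "range j \<subseteq> so"
    and "orthonormal_basis B"
  shows "type_A (nil_metric j) \<longleftrightarrow> (\<forall>Z. J_op B j o\<^sub>L j Z \<in> so)"
proof -
  interpret two_step_nilpotent j using assms(1,2) by (rule two_step_nilpotent.intro)
  show ?thesis
    by (simp add: type_A_iff_J_op[OF assms(3)] so_iff_inner_self)
qed

end
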